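(* Let $(D_\lambda)_{\lambda\in\Lambda}$ be a family of integral domains of finite character, none of which is a field, and let $R=\prod_{\lambda\in\Lambda}D_\lambda$. Then the maximal ideals of $R$ are exactly the ideals of the form $(\mathcal{U})$, where $\mathcal{U}$ is an ultrafilter in the Boolean algebra $\mathcal{B}=\prod_{\lambda\in\Lambda}\mathcal{P}(\max(D_\lambda))$ containing an element $Y=(Y_\lambda)_{\lambda\in\Lambda}$ such that $Y_\lambda$ is finite for all $\lambda\in\Lambda$.
   Context: A ring $D$ is of finite character if every non-zero element of $D$ is contained in at most finitely many maximal ideals. For a commutative ring $D$ with identity, $\max(D)$ is the set of maximal ideals of $D$ and, for $a\in D$, $\mathscr{V}(a)=\{M\in\max(D)\mid a\in M\}$. $\mathcal{B}$ carries the componentwise Boolean operations (least element $(\emptyset)_\lambda$; $Y\le Z$ iff $Y_\lambda\subseteq Z_\lambda$ for all $\lambda$); an ultrafilter in $\mathcal{B}$ is a maximal proper filter. For $a=(a_\lambda)\in R$, $S(a)=(\mathscr{V}(a_\lambda))_{\lambda\in\Lambda}\in\mathcal{B}$, and $(\mathcal{U})=\{a\in R\mid S(a)\in\mathcal{U}\}$. *)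

theory Defs
  imports "HOL-Algebra.Algebra"
begin

section \<open>Maximal spectra and finite character\<close>

definition max_spec :: "('a, 'm) ring_scheme \<Rightarrow> 'a set set"
  where "max_spec D = {M. maximalideal M D}"

definition max_locus :: "('a, 'm) ring_scheme \<Rightarrow> 'a \<Rightarrow> 'a set set"
  where "max_locus D a = {M \<in> max_spec D. a \<in> M}"

definition finite_character :: "('a, 'm) ring_scheme \<Rightarrow> bool"
  where "finite_character D \<longleftrightarrow> (\<forall>a \<in> carrier D. a \<noteq> \<zero>\<^bsub>D\<^esub> \<longrightarrow> finite (max_locus D a))"


section \<open>Product of a family of rings\<close>

definition product_ring :: "'i set \<Rightarrow> ('i \<Rightarrow> ('a, 'm) ring_scheme) \<Rightarrow> ('i \<Rightarrow> 'a) ring"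
  where "product_ring I D =
    \<lparr>carrier = (\<Pi>\<^sub>E i\<in>I. carrier (D i)),
     monoid.mult = (\<lambda>x y. \<lambda>i\<in>I. x i \<otimes>\<^bsub>D i\<^esub> y i),
     monoid.one = (\<lambda>i\<in>I. \<one>\<^bsub>D i\<^esub>),
     ring.zero = (\<lambda>i\<in>I. \<zero>\<^bsub>D i\<^esub>),
     ring.add = (\<lambda>x y. \<lambda>i\<in>I. x i \<oplus>\<^bsub>D i\<^esub> y i)\<rparr>"

lemma product_ring_cring:
  assumes "\<And>i. i \<in> I \<Longrightarrow> cring (D i)"
  shows "cring (product_ring I D)"
proof -
  have R: "ring (D i)" if "i \<in> I" for i
    using assms[OF that] by (rule cring.axioms)
  note clo = ring.ring_simprules(1,2,5,6)[OF R]
  note ac = cring.cring_simprules(7,10,23)[OF assms]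
  note mc = cring.cring_simprules(11,14,24)[OF assms]
  show ?thesis
  proof (rule cringI)
    show "abelian_group (product_ring I D)"
    proof (rule abelian_groupI)
      fix x assume x: "x \<in> carrier (product_ring I D)"
      show "\<exists>y\<in>carrier (product_ring I D).
              y \<oplus>\<^bsub>product_ring I D\<^esub> x = \<zero>\<^bsub>product_ring I D\<^esub>"
      proof
        show "(\<lambda>i\<in>I. \<ominus>\<^bsub>D i\<^esub> x i) \<in> carrier (product_ring I D)"
          using x by (auto simp: product_ring_def PiE_iff ring.ring_simprules(3)[OF R])
        show "(\<lambda>i\<in>I. \<ominus>\<^bsub>D i\<^esub> x i) \<oplus>\<^bsub>product_ring I D\<^esub> x = \<zero>\<^bsub>product_ring I D\<^esub>"
          using x by (auto simp: product_ring_def PiE_iff ring.ring_simprules(9)[OF R]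
              intro!: restrict_ext)
      qed
    next
      fix x assume x: "x \<in> carrier (product_ring I D)"
      show "\<zero>\<^bsub>product_ring I D\<^esub> \<oplus>\<^bsub>product_ring I D\<^esub> x = x"
        using x by (auto simp: product_ring_def PiE_iff ring.ring_simprules(8)[OF R]
            extensional_def)
    qed (auto simp: product_ring_def PiE_iff clo ac intro!: restrict_ext)
    show "comm_monoid (product_ring I D)"
    proof (rule comm_monoidI)
      fix x assume x: "x \<in> carrier (product_ring I D)"
      show "\<one>\<^bsub>product_ring I D\<^esub> \<otimes>\<^bsub>product_ring I D\<^esub> x = x"
        using x by (auto simp: product_ring_def PiE_iff
            ring.ring_simprules(12)[OF R] extensional_def)
    qed (auto simp: product_ring_def PiE_iff clo mc intro!: restrict_ext)
  qed (auto simp: product_ring_def PiE_iff clo ring.ring_simprules(13)[OF R]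
        intro!: restrict_ext)
qed


section \<open>Filters and ultrafilters in a lattice\<close>

definition lattice_filter :: "('b, 'm) gorder_scheme \<Rightarrow> 'b set \<Rightarrow> bool"
  where "lattice_filter L F \<longleftrightarrow> F \<subseteq> carrier L \<and> F \<noteq> {}
    \<and> (\<forall>x\<in>F. \<forall>y\<in>F. x \<sqinter>\<^bsub>L\<^esub> y \<in> F)
    \<and> (\<forall>x\<in>F. \<forall>y\<in>carrier L. x \<sqsubseteq>\<^bsub>L\<^esub> y \<longrightarrow> y \<in> F)"

definition proper_lattice_filter :: "('b, 'm) gorder_scheme \<Rightarrow> 'b set \<Rightarrow> bool"
  where "proper_lattice_filter L F \<longleftrightarrow> lattice_filter L F \<and> F \<noteq> carrier L"

definition lattice_ultrafilter :: "('b, 'm) gorder_scheme \<Rightarrow> 'b set \<Rightarrow> bool"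
  where "lattice_ultrafilter L U \<longleftrightarrow> proper_lattice_filter L U
    \<and> (\<forall>F. proper_lattice_filter L F \<and> U \<subseteq> F \<longrightarrow> F = U)"


section \<open>Product of powerset algebras\<close>

text \<open>The Boolean algebra is given by its order; the lattice operations of HOL-Algebra are
  determined by it. The lemmas confirm that meets, joins, bottom and top are the componentwise
  ones, and that componentwise set difference from the top element is a complement.\<close>

definition product_Pow :: "'i set \<Rightarrow> ('i \<Rightarrow> 'b set) \<Rightarrow> ('i \<Rightarrow> 'b set) gorder"
  where "product_Pow I A =
    \<lparr>carrier = (\<Pi>\<^sub>E i\<in>I. Pow (A i)), eq = (=), le = (\<lambda>Y Z. \<forall>i\<in>I. Y i \<subseteq> Z i)\<rparr>"

lemma product_Pow_partial_order: "partial_order (product_Pow I A)"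
proof -
  have "x = y" if xy: "x \<in> (\<Pi>\<^sub>E i\<in>I. Pow (A i))" "y \<in> (\<Pi>\<^sub>E i\<in>I. Pow (A i))"
    and le: "\<forall>i\<in>I. x i \<subseteq> y i" "\<forall>i\<in>I. y i \<subseteq> x i" for x y
  proof (rule PiE_ext[OF xy])
    fix i assume "i \<in> I"
    with le show "x i = y i"
      by (intro subset_antisym) simp_all
  qed
  then show ?thesis
    by unfold_locales (simp_all add: product_Pow_def, blast)
qed

lemma product_Pow_greatest_meet:
  assumes "Y \<in> carrier (product_Pow I A)" "Z \<in> carrier (product_Pow I A)"
  shows "greatest (product_Pow I A) (\<lambda>i\<in>I. Y i \<inter> Z i) (Lower (product_Pow I A) {Y, Z})"
proof -
  have "(\<lambda>i\<in>I. Y i \<inter> Z i) \<in> carrier (product_Pow I A)"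
    using assms by (auto simp: product_Pow_def)
  with assms show ?thesis
    by (simp add: greatest_def Lower_def product_Pow_def)
qed

lemma product_Pow_least_join:
  assumes "Y \<in> carrier (product_Pow I A)" "Z \<in> carrier (product_Pow I A)"
  shows "least (product_Pow I A) (\<lambda>i\<in>I. Y i \<union> Z i) (Upper (product_Pow I A) {Y, Z})"
proof -
  have "(\<lambda>i\<in>I. Y i \<union> Z i) \<in> carrier (product_Pow I A)"
    using assms by (fastforce simp: product_Pow_def)
  with assms show ?thesis
    by (simp add: least_def Upper_def product_Pow_def)
qed

lemma product_Pow_lattice: "lattice (product_Pow I A)"
proof -
  interpret partial_order "product_Pow I A"
    by (rule product_Pow_partial_order)
  show ?thesis
  proof
    fix Y Z assume YZ: "Y \<in> carrier (product_Pow I A)" "Z \<in> carrier (product_Pow I A)"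
    show "\<exists>s. least (product_Pow I A) s (Upper (product_Pow I A) {Y, Z})"
      by (intro exI) (rule product_Pow_least_join[OF YZ])
    show "\<exists>s. greatest (product_Pow I A) s (Lower (product_Pow I A) {Y, Z})"
      by (intro exI) (rule product_Pow_greatest_meet[OF YZ])
  qed
qed

lemma product_Pow_meet:
  assumes "Y \<in> carrier (product_Pow I A)" "Z \<in> carrier (product_Pow I A)"
  shows "Y \<sqinter>\<^bsub>product_Pow I A\<^esub> Z = (\<lambda>i\<in>I. Y i \<inter> Z i)"
  unfolding meet_def inf_def
  by (rule some_equality, rule product_Pow_greatest_meet[OF assms],
      rule partial_order.greatest_unique[OF product_Pow_partial_order _ product_Pow_greatest_meet[OF assms]])

lemma product_Pow_join:
  assumes "Y \<in> carrier (product_Pow I A)" "Z \<in> carrier (product_Pow I A)"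
  shows "Y \<squnion>\<^bsub>product_Pow I A\<^esub> Z = (\<lambda>i\<in>I. Y i \<union> Z i)"
  unfolding join_def sup_def
  by (rule some_equality, rule product_Pow_least_join[OF assms],
      rule partial_order.least_unique[OF product_Pow_partial_order _ product_Pow_least_join[OF assms]])

lemma product_Pow_bottom: "\<bottom>\<^bsub>product_Pow I A\<^esub> = (\<lambda>i\<in>I. {})"
proof -
  have *: "least (product_Pow I A) (\<lambda>i\<in>I. {}) (carrier (product_Pow I A))"
    unfolding least_def product_Pow_def by (auto simp: PiE_iff)
  show ?thesis
    unfolding bottom_def
    by (rule some_equality, rule *,
      rule partial_order.least_unique[OF product_Pow_partial_order _ *])
qed

lemma product_Pow_top: "\<top>\<^bsub>product_Pow I A\<^esub> = (\<lambda>i\<in>I. A i)"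
proof -
  have *: "greatest (product_Pow I A) (\<lambda>i\<in>I. A i) (carrier (product_Pow I A))"
    unfolding greatest_def product_Pow_def by (auto simp: PiE_iff)
  show ?thesis
    unfolding top_def
    by (rule some_equality, rule *,
      rule partial_order.greatest_unique[OF product_Pow_partial_order _ *])
qed

lemma product_Pow_complement:
  assumes "Y \<in> carrier (product_Pow I A)"
  shows "(\<lambda>i\<in>I. A i - Y i) \<in> carrier (product_Pow I A)"
    and "Y \<sqinter>\<^bsub>product_Pow I A\<^esub> (\<lambda>i\<in>I. A i - Y i) = \<bottom>\<^bsub>product_Pow I A\<^esub>"
    and "Y \<squnion>\<^bsub>product_Pow I A\<^esub> (\<lambda>i\<in>I. A i - Y i) = \<top>\<^bsub>product_Pow I A\<^esub>"
proof -
  show c: "(\<lambda>i\<in>I. A i - Y i) \<in> carrier (product_Pow I A)"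
    by (auto simp: product_Pow_def)
  show "Y \<sqinter>\<^bsub>product_Pow I A\<^esub> (\<lambda>i\<in>I. A i - Y i) = \<bottom>\<^bsub>product_Pow I A\<^esub>"
    by (auto simp: product_Pow_meet[OF assms c] product_Pow_bottom intro!: restrict_ext)
  have "Y i \<subseteq> A i" if "i \<in> I" for i
    using assms that by (auto simp: product_Pow_def)
  then show "Y \<squnion>\<^bsub>product_Pow I A\<^esub> (\<lambda>i\<in>I. A i - Y i) = \<top>\<^bsub>product_Pow I A\<^esub>"
    by (auto simp: product_Pow_join[OF assms c] product_Pow_top intro!: restrict_ext)
qed

lemma proper_product_Pow_filter_iff:
  "proper_lattice_filter (product_Pow I A) F \<longleftrightarrow>
     lattice_filter (product_Pow I A) F \<and> (\<lambda>i\<in>I. {}) \<notin> F"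
proof -
  have b: "(\<lambda>i\<in>I. {}) \<in> carrier (product_Pow I A)"
    by (auto simp: product_Pow_def)
  have "F = carrier (product_Pow I A)"
    if F: "lattice_filter (product_Pow I A) F" and bF: "(\<lambda>i\<in>I. {}) \<in> F"
  proof
    show "F \<subseteq> carrier (product_Pow I A)"
      using F by (simp add: lattice_filter_def)
    show "carrier (product_Pow I A) \<subseteq> F"
    proof
      fix Y assume Y: "Y \<in> carrier (product_Pow I A)"
      have "(\<lambda>i\<in>I. {}) \<sqsubseteq>\<^bsub>product_Pow I A\<^esub> Y"
        by (auto simp: product_Pow_def)
      with F bF Y show "Y \<in> F"
        unfolding lattice_filter_def by blast
    qed
  qed
  with b show ?thesis
    unfolding proper_lattice_filter_def by blast
qed


section \<open>Ideals of the product ring attached to filters\<close>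

definition max_algebra ::
    "'i set \<Rightarrow> ('i \<Rightarrow> ('a, 'm) ring_scheme) \<Rightarrow> ('i \<Rightarrow> 'a set set) gorder"
  where "max_algebra I D = product_Pow I (\<lambda>i. max_spec (D i))"

definition locus_family ::
    "'i set \<Rightarrow> ('i \<Rightarrow> ('a, 'm) ring_scheme) \<Rightarrow> ('i \<Rightarrow> 'a) \<Rightarrow> 'i \<Rightarrow> 'a set set"
  where "locus_family I D a = (\<lambda>i\<in>I. max_locus (D i) (a i))"

definition filter_ideal ::
    "'i set \<Rightarrow> ('i \<Rightarrow> ('a, 'm) ring_scheme) \<Rightarrow> ('i \<Rightarrow> 'a set set) set \<Rightarrow> ('i \<Rightarrow> 'a) set"
  where "filter_ideal I D U = {a \<in> carrier (product_ring I D). locus_family I D a \<in> U}"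

lemma locus_family_closed: "locus_family I D a \<in> carrier (max_algebra I D)"
  by (auto simp: locus_family_def max_algebra_def product_Pow_def max_locus_def)

end

theory Submission
  imports Defs
begin

text \<open>For an ultrafilter \<open>U\<close> with a componentwise finite element and \<open>a \<notin> (U)\<close>, some componentwise
  finite \<open>Z \<in> U\<close> is disjoint from \<open>S(a)\<close>; since \<open>a\<^sub>i\<close> is comaximal with the intersection of the finitely many
  members of \<open>Z\<^sub>i\<close>, one gets \<open>1 = r a + b\<close> with \<open>Z \<le> S(b)\<close>, so \<open>b \<in> (U)\<close> and \<open>(U)\<close> is maximal.
  Conversely, for a maximal ideal \<open>M\<close>, finitely many elements of \<open>M\<close> cannot generate the unit ideal in
  every component, so the sets \<open>S(a)\<close> with \<open>a \<in> M\<close> have the finite meet property and lie in an ultrafilter \<open>U\<close>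
  with \<open>M \<subseteq> (U)\<close>. As no \<open>D\<^sub>i\<close> is a field, \<open>M\<close> contains an element \<open>m\<close> without zero components, and \<open>S(m)\<close> is
  componentwise finite by finite character; hence \<open>(U)\<close> is a proper ideal and equals \<open>M\<close>.\<close>

section \<open>Ideals of a single commutative ring: Zorn's lemma and comaximality\<close>

section \<open>Maximal ideals of commutative rings\<close>

text \<open>Additive inverses come for free as multiplication by \<open>\<ominus> \<one>\<close>,
  and commutativity turns left multiples into right ones.\<close>

lemma (in cring) idealI_closed:
  assumes sub: "J \<subseteq> carrier R" and z: "\<zero> \<in> J"
    and add: "\<And>a b. a \<in> J \<Longrightarrow> b \<in> J \<Longrightarrow> a \<oplus> b \<in> J"
    and mult: "\<And>r a. r \<in> carrier R \<Longrightarrow> a \<in> J \<Longrightarrow> r \<otimes> a \<in> J"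
  shows "ideal J R"
proof (rule idealI)
  show "ring R" by (rule ring_axioms)
  show "subgroup J (add_monoid R)"
  proof (rule add.subgroupI)
    show "\<ominus> a \<in> J" if "a \<in> J" for a
    proof -
      have "\<ominus> a = (\<ominus> \<one>) \<otimes> a"
        using l_minus[of \<one> a] that sub by auto
      then show ?thesis
        using mult[of "\<ominus> \<one>" a] that by simp
    qed
  qed (use sub z add in auto)
  show "x \<otimes> a \<in> J" "a \<otimes> x \<in> J" if "a \<in> J" "x \<in> carrier R" for a x
    using mult[of x a] that sub m_comm[of x a] by auto
qed

text \<open>Any two elements of the union already lie in a common member of the chain. This supplies
  the upper bounds for Zorn's lemma in \<open>exists_maximalideal\<close>.\<close>

lemma (in cring) ideal_Union_chain:
  assumes "\<C> \<noteq> {}" and "\<And>J. J \<in> \<C> \<Longrightarrow> ideal J R"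
    and chain: "\<And>J K. J \<in> \<C> \<Longrightarrow> K \<in> \<C> \<Longrightarrow> J \<subseteq> K \<or> K \<subseteq> J"
  shows "ideal (\<Union>\<C>) R"
proof (rule idealI_closed)
  note additive = assms(2)[THEN ideal.axioms(1)]
  show "\<Union>\<C> \<subseteq> carrier R"
    using additive_subgroup.a_subset[OF additive] by blast
  show "\<zero> \<in> \<Union>\<C>"
    using assms(1) additive_subgroup.zero_closed[OF additive] by blast
  show "a \<oplus> b \<in> \<Union>\<C>" if ab: "a \<in> \<Union>\<C>" "b \<in> \<Union>\<C>" for a b
  proof -
    obtain J K where JK: "J \<in> \<C>" "K \<in> \<C>" "a \<in> J" "b \<in> K"
      using ab by blast
    then obtain L where "L \<in> \<C>" "a \<in> L" "b \<in> L"
      using chain[OF JK(1,2)] by blast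
    then show ?thesis
      using additive_subgroup.a_closed[OF additive] by blast
  qed
  show "r \<otimes> a \<in> \<Union>\<C>" if "r \<in> carrier R" "a \<in> \<Union>\<C>" for r a
    using that ideal.I_l_closed[OF assms(2)] by blast
qed

text \<open>Krull's theorem. Properness is expressed by omitting \<open>\<one>\<close>, a condition
  that passes to unions of chains.\<close>

lemma (in cring) exists_maximalideal:
  assumes "ideal J R" "\<one> \<notin> J"
  shows "\<exists>M\<in>max_spec R. J \<subseteq> M"
proof -
  let ?A = "{K. ideal K R \<and> J \<subseteq> K \<and> \<one> \<notin> K}"
  have "\<exists>M\<in>?A. \<forall>V\<in>?A. M \<subseteq> V \<longrightarrow> V = M"
  proof (rule subset_Zorn_nonempty)
    show "?A \<noteq> {}" using assms by blast
    fix \<C> assume "\<C> \<noteq> {}" "subset.chain ?A \<C>"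
    moreover from this have "ideal (\<Union>\<C>) R"
      by (intro ideal_Union_chain) (auto simp: subset_chain_def)
    ultimately show "\<Union>\<C> \<in> ?A"
      by (auto simp: subset_chain_def)
  qed
  then obtain M where M: "M \<in> ?A" and max: "\<forall>V\<in>?A. M \<subseteq> V \<longrightarrow> V = M"
    by (rule bexE)
  have "maximalideal M R"
  proof (rule maximalidealI)
    show "ideal M R" "carrier R \<noteq> M" using M by auto
    show "V = M \<or> V = carrier R" if V: "ideal V R" "M \<subseteq> V" for V
    proof (cases "\<one> \<in> V")
      case True
      then show ?thesis
        using ideal.one_imp_carrier[OF V(1)] by simp
    next
      case False
      then have "V \<in> ?A"
        using M V by auto
      with max V(2) show ?thesis by simp
    qed
  qed
  then show ?thesis
    using M by (auto simp: max_spec_def)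
qed

lemma max_specD:
  assumes "M \<in> max_spec R"
  shows "ideal M R" "\<one>\<^bsub>R\<^esub> \<notin> M"
proof -
  interpret maximalideal M R
    using assms by (simp add: max_spec_def)
  show "ideal M R" by (rule is_ideal)
  show "\<one>\<^bsub>R\<^esub> \<notin> M"
    using one_imp_carrier I_notcarr by blast
qed

text \<open>The ideal generated by a union is the sum of the ideals generated by the two parts, here
  \<open>PIdl a\<close> and \<open>Idl B\<close>.\<close>

lemma (in cring) genideal_insertE:
  assumes "a \<in> carrier R" "B \<subseteq> carrier R" "x \<in> Idl (insert a B)"
  obtains r b where "r \<in> carrier R" "b \<in> Idl B" "x = r \<otimes> a \<oplus> b"
proof -
  have B: "ideal (Idl B) R"
    by (rule genideal_ideal[OF assms(2)])
  have a: "ideal (PIdl a) R"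
    by (rule cgenideal_ideal[OF assms(1)])
  have "Idl (insert a B) \<subseteq> Idl (PIdl a \<union> Idl B)"
  proof (rule genideal_minimal[OF genideal_ideal])
    show c: "PIdl a \<union> Idl B \<subseteq> carrier R"
      using B a by (simp add: additive_subgroup.a_subset ideal.axioms(1))
    show "insert a B \<subseteq> Idl (PIdl a \<union> Idl B)"
      using genideal_self[OF c] genideal_self[OF assms(2)] cgenideal_self[OF assms(1)] by blast
  qed
  then have "x \<in> PIdl a <+> Idl B"
    using assms(3) union_genideal[OF a B] by blast
  then show thesis
    using that by (auto simp: set_add_def' cgenideal_def)
qed

text \<open>By maximality, \<open>M\<close> together with \<open>a\<close> generates the unit
  ideal.\<close>

lemma (in cring) max_spec_one_split:
  assumes M: "M \<in> max_spec R" and a: "a \<in> carrier R" "a \<notin> M"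
  obtains r m where "r \<in> carrier R" "m \<in> M" "\<one> = r \<otimes> a \<oplus> m"
proof -
  interpret maximalideal M R
    using M by (simp add: max_spec_def)
  have c: "insert a M \<subseteq> carrier R"
    using a(1) a_subset by blast
  have "Idl M = M"
    using genideal_self[OF a_subset] genideal_minimal[OF is_ideal] by blast
  have "Idl (insert a M) = carrier R"
    using I_maximal[OF genideal_ideal[OF c]] genideal_self[OF c] a(2)
      additive_subgroup.a_subset[OF ideal.axioms(1)[OF genideal_ideal[OF c]]] by blast
  then have "\<one> \<in> Idl (insert a M)"
    by simp
  then show thesis
    using genideal_insertE[OF a(1) a_subset] that \<open>Idl M = M\<close> by metis
qed

text \<open>Converse of \<open>max_spec_one_split\<close>: a larger ideal contains some
  \<open>a\<close> outside \<open>M\<close>, hence also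
  \<open>r \<otimes> a \<oplus> m = \<one>\<close>. In a product ring such an equation can be built
  component by component.\<close>

lemma (in cring) max_specI_one_split:
  assumes M: "ideal M R" "\<one> \<notin> M"
    and split: "\<And>a. a \<in> carrier R \<Longrightarrow> a \<notin> M \<Longrightarrow> \<exists>r\<in>carrier R. \<exists>m\<in>M. \<one> = r \<otimes> a \<oplus> m"
  shows "M \<in> max_spec R"
  unfolding max_spec_def
proof (rule CollectI, rule maximalidealI[OF M(1)])
  show "carrier R \<noteq> M" using M(2) by blast
  show "V = M \<or> V = carrier R" if V: "ideal V R" "M \<subseteq> V" for V
  proof (rule disjCI)
    interpret V: ideal V R by (rule V(1))
    assume "V \<noteq> carrier R"
    then have "\<one> \<notin> V"
      using V.one_imp_carrier by blast
    have "a \<in> M" if a: "a \<in> V" for a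
    proof (rule ccontr)
      assume "a \<notin> M"
      with split obtain r m where "r \<in> carrier R" "m \<in> M" "\<one> = r \<otimes> a \<oplus> m"
        using a V.a_subset by blast
      with a V(2) have "\<one> \<in> V"
        using V.I_l_closed V.a_closed by auto
      with \<open>\<one> \<notin> V\<close> show False ..
    qed
    with V(2) show "V = M" by blast
  qed
qed

text \<open>Comaximality of \<open>a\<close> with each of finitely many maximal ideals passes to
  their intersection, by multiplying the representations of \<open>\<one>\<close>.\<close>

lemma (in cring) one_split_finite:
  assumes "finite Z" "Z \<subseteq> max_spec R" and a: "a \<in> carrier R" and "\<And>N. N \<in> Z \<Longrightarrow> a \<notin> N"
  shows "\<exists>r\<in>carrier R. \<exists>b\<in>carrier R. \<one> = r \<otimes> a \<oplus> b \<and> (\<forall>N\<in>Z. b \<in> N)"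
  using assms(1,2,4)
proof (induction Z rule: finite_induct)
  case empty
  show ?case
    by (intro bexI[of _ \<zero>] bexI[of _ \<one>]) (auto simp: a)
next
  case (insert M Z)
  then obtain r b where rb: "r \<in> carrier R" "b \<in> carrier R" "\<one> = r \<otimes> a \<oplus> b" "\<forall>N\<in>Z. b \<in> N"
    by auto
  have M: "M \<in> max_spec R" "a \<notin> M"
    using insert.prems by auto
  obtain s m where sm: "s \<in> carrier R" "m \<in> M" "\<one> = s \<otimes> a \<oplus> m"
    by (rule max_spec_one_split[OF M(1) a M(2)])
  have m: "m \<in> carrier R"
    using sm(2) max_specD(1)[OF M(1)] by (meson ideal.Icarr)
  \<comment> \<open>Expanding the product, every term except \<open>b \<otimes> m\<close> is a
    multiple of \<open>a\<close>, and \<open>b \<otimes> m\<close> lies in \<open>M\<close> through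
    \<open>m\<close> and in the members of \<open>Z\<close> through \<open>b\<close>.\<close>
  have "\<one> = \<one> \<otimes> \<one>"
    by simp
  also have "\<dots> = (r \<otimes> a \<oplus> b) \<otimes> (s \<otimes> a \<oplus> m)"
    by (rule arg_cong2[OF rb(3) sm(3)])
  also have "\<dots> = (r \<otimes> (s \<otimes> a \<oplus> m) \<oplus> b \<otimes> s) \<otimes> a \<oplus> b \<otimes> m"
    using a rb(1,2) sm(1) m by algebra
  finally have one: "\<one> = (r \<otimes> (s \<otimes> a \<oplus> m) \<oplus> b \<otimes> s) \<otimes> a \<oplus> b \<otimes> m" .
  have "b \<otimes> m \<in> M"
    using ideal.I_l_closed[OF max_specD(1)[OF M(1)] sm(2) rb(2)] .
  moreover have "b \<otimes> m \<in> N" if "N \<in> Z" for N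
    using ideal.I_r_closed[OF max_specD(1), of N R b m] rb(4) m insert.prems(1) that by blast
  ultimately show ?case
    using one a rb(1,2) sm(1) m
    by (intro bexI[of _ "r \<otimes> (s \<otimes> a \<oplus> m) \<oplus> b \<otimes> s"] bexI[of _ "b \<otimes> m"]) auto
qed

text \<open>If the zero ideal were maximal, the ring would be a field; so any maximal ideal has a
  non-zero element, which is then a non-unit.\<close>

lemma (in cring) max_spec_nonzero_member:
  assumes "\<one> \<noteq> \<zero>" "\<not> field R"
  obtains N t where "N \<in> max_spec R" "t \<in> N" "t \<noteq> \<zero>"
proof -
  obtain N where N: "N \<in> max_spec R"
    using exists_maximalideal[OF zeroideal] assms(1) by auto
  have "N \<noteq> {\<zero>}"
    using N zeromaximalideal_fieldI assms(2) by (auto simp: max_spec_def)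
  moreover have "\<zero> \<in> N"
    using max_specD(1)[OF N] by (simp add: additive_subgroup.zero_closed ideal.axioms(1))
  ultimately show thesis
    using that N by blast
qed


section \<open>Ultrafilters in products of powersets\<close>

text \<open>The meet in \<open>lattice_filter\<close> is an abstract infimum; once it is replaced by
  componentwise intersection, filter arguments become plain set computations.\<close>

lemma lattice_filter_product_Pow_iff:
  "lattice_filter (product_Pow I A) F \<longleftrightarrow> F \<subseteq> (\<Pi>\<^sub>E i\<in>I. Pow (A i)) \<and> F \<noteq> {}
    \<and> (\<forall>V\<in>F. \<forall>Y\<in>F. (\<lambda>i\<in>I. V i \<inter> Y i) \<in> F)
    \<and> (\<forall>V\<in>F. \<forall>Y\<in>(\<Pi>\<^sub>E i\<in>I. Pow (A i)). (\<forall>i\<in>I. V i \<subseteq> Y i) \<longrightarrow> Y \<in> F)"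
proof -
  have [simp]: "carrier (product_Pow I A) = (\<Pi>\<^sub>E i\<in>I. Pow (A i))"
    and [simp]: "V \<sqsubseteq>\<^bsub>product_Pow I A\<^esub> Y \<longleftrightarrow> (\<forall>i\<in>I. V i \<subseteq> Y i)" for V Y
    by (simp_all add: product_Pow_def)
  have "V \<sqinter>\<^bsub>product_Pow I A\<^esub> Y = (\<lambda>i\<in>I. V i \<inter> Y i)"
    if "F \<subseteq> (\<Pi>\<^sub>E i\<in>I. Pow (A i))" "V \<in> F" "Y \<in> F" for V Y
    using product_Pow_meet[of V I A Y] that by auto
  then show ?thesis
    unfolding lattice_filter_def by auto
qed

lemma product_Pow_filter_Int:
  assumes F: "lattice_filter (product_Pow I A) F" and "V \<in> F" "W \<in> F"
  shows "(\<lambda>i\<in>I. V i \<inter> W i) \<in> F"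
proof -
  have "\<forall>V\<in>F. \<forall>W\<in>F. (\<lambda>i\<in>I. V i \<inter> W i) \<in> F"
    using F unfolding lattice_filter_product_Pow_iff by (elim conjE)
  with assms(2-) show ?thesis
    by blast
qed

lemma product_Pow_filter_mono:
  assumes F: "lattice_filter (product_Pow I A) F" and "V \<in> F"
    and "W \<in> (\<Pi>\<^sub>E i\<in>I. Pow (A i))" "\<And>i. i \<in> I \<Longrightarrow> V i \<subseteq> W i"
  shows "W \<in> F"
proof -
  have "\<forall>V\<in>F. \<forall>W\<in>(\<Pi>\<^sub>E i\<in>I. Pow (A i)). (\<forall>i\<in>I. V i \<subseteq> W i) \<longrightarrow> W \<in> F"
    using F unfolding lattice_filter_product_Pow_iff by (elim conjE)
  with assms(2-) show ?thesis
    by simp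
qed

text \<open>Zorn's lemma on the proper filters above \<open>F\<close>: properness means omitting the
  bottom element, which unions of chains preserve.\<close>

lemma lattice_ultrafilter_extends:
  assumes "proper_lattice_filter (product_Pow I A) F"
  obtains U where "lattice_ultrafilter (product_Pow I A) U" "F \<subseteq> U"
proof -
  let ?A = "{G. proper_lattice_filter (product_Pow I A) G \<and> F \<subseteq> G}"
  have "\<exists>U\<in>?A. \<forall>V\<in>?A. U \<subseteq> V \<longrightarrow> V = U"
  proof (rule subset_Zorn_nonempty)
    show "?A \<noteq> {}" using assms by blast
    fix \<C> assume ne: "\<C> \<noteq> {}" and "subset.chain ?A \<C>"
    then have \<C>: "proper_lattice_filter (product_Pow I A) G" "F \<subseteq> G" if "G \<in> \<C>" for G
      using that by (auto simp: subset_chain_def)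
    have chain: "G \<subseteq> H \<or> H \<subseteq> G" if "G \<in> \<C>" "H \<in> \<C>" for G H
      using \<open>subset.chain ?A \<C>\<close> that by (simp add: subset_chain_def)
    note filt = \<C>(1)[unfolded proper_product_Pow_filter_iff lattice_filter_product_Pow_iff]
    have "lattice_filter (product_Pow I A) (\<Union>\<C>)"
      unfolding lattice_filter_product_Pow_iff
    proof (intro conjI ballI impI)
      show "\<Union>\<C> \<subseteq> (\<Pi>\<^sub>E i\<in>I. Pow (A i))"
        using filt by blast
      show "\<Union>\<C> \<noteq> {}"
        using ne filt by blast
      show "(\<lambda>i\<in>I. V i \<inter> Y i) \<in> \<Union>\<C>" if XY: "V \<in> \<Union>\<C>" "Y \<in> \<Union>\<C>" for V Y
      proof -
        obtain G H where GH: "G \<in> \<C>" "H \<in> \<C>" "V \<in> G" "Y \<in> H"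
          using XY by blast
        then obtain K where "K \<in> \<C>" "V \<in> K" "Y \<in> K"
          using chain[OF GH(1,2)] by blast
        then show ?thesis
          using filt by blast
      qed
      show "Y \<in> \<Union>\<C>" if "V \<in> \<Union>\<C>" "Y \<in> (\<Pi>\<^sub>E i\<in>I. Pow (A i))" "\<forall>i\<in>I. V i \<subseteq> Y i" for V Y
        using that filt by blast
    qed
    then show "\<Union>\<C> \<in> ?A"
      using filt \<C>(2) ne unfolding proper_product_Pow_filter_iff by blast
  qed
  then obtain U where U: "U \<in> ?A" and max: "\<forall>V\<in>?A. U \<subseteq> V \<longrightarrow> V = U"
    by (rule bexE)
  \<comment> \<open>Maximality among the filters above \<open>F\<close> is maximality among all
    proper filters, since whatever contains \<open>U\<close> contains \<open>F\<close>.\<close>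
  have "G = U" if "proper_lattice_filter (product_Pow I A) G" "U \<subseteq> G" for G
  proof -
    have "G \<in> ?A"
      using U that by auto
    with max that(2) show ?thesis
      by simp
  qed
  with U show thesis
    by (intro that[of U]) (auto simp: lattice_ultrafilter_def)
qed

text \<open>Adjoining \<open>Y\<close> to \<open>U\<close> destroys properness, so some member of
  \<open>U\<close> is disjoint from \<open>Y\<close> and hence lies below its complement.\<close>

lemma lattice_ultrafilter_complement:
  assumes U: "lattice_ultrafilter (product_Pow I A) U"
    and Y: "Y \<in> (\<Pi>\<^sub>E i\<in>I. Pow (A i))" "Y \<notin> U"
  shows "(\<lambda>i\<in>I. A i - Y i) \<in> U"
proof -
  have proper: "proper_lattice_filter (product_Pow I A) U"
    and max: "\<And>F. proper_lattice_filter (product_Pow I A) F \<Longrightarrow> U \<subseteq> F \<Longrightarrow> F = U"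
    using U by (auto simp: lattice_ultrafilter_def)
  have filt: "lattice_filter (product_Pow I A) U"
    using proper by (simp add: proper_lattice_filter_def)
  note inter = product_Pow_filter_Int[OF filt] and up = product_Pow_filter_mono[OF filt]
  have sub: "V \<in> (\<Pi>\<^sub>E i\<in>I. Pow (A i))" if "V \<in> U" for V
    using filt that unfolding lattice_filter_product_Pow_iff by blast
  \<comment> \<open>The filter generated by \<open>U\<close> and \<open>Y\<close>.\<close>
  let ?G = "{Z \<in> (\<Pi>\<^sub>E i\<in>I. Pow (A i)). \<exists>V\<in>U. \<forall>i\<in>I. V i \<inter> Y i \<subseteq> Z i}"
  obtain V\<^sub>0 where "V\<^sub>0 \<in> U"
    using filt by (auto simp: lattice_filter_def)
  then have "Y \<in> ?G"
    using Y(1) by blast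
  moreover have "U \<subseteq> ?G"
    using sub by blast
  ultimately have "\<not> proper_lattice_filter (product_Pow I A) ?G"
    using max[of ?G] Y(2) by blast
  moreover have "lattice_filter (product_Pow I A) ?G"
    unfolding lattice_filter_product_Pow_iff
  proof (intro conjI ballI impI)
    show "?G \<noteq> {}" using \<open>Y \<in> ?G\<close> by blast
    show "(\<lambda>i\<in>I. Z i \<inter> Z' i) \<in> ?G" if Z: "Z \<in> ?G" "Z' \<in> ?G" for Z Z'
    proof -
      obtain V V' where V: "V \<in> U" "V' \<in> U"
        "\<forall>i\<in>I. V i \<inter> Y i \<subseteq> Z i" "\<forall>i\<in>I. V' i \<inter> Y i \<subseteq> Z' i"
        using Z by blast
      have "(\<lambda>i\<in>I. Z i \<inter> Z' i) \<in> (\<Pi>\<^sub>E i\<in>I. Pow (A i))"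
        using Z by (auto simp: PiE_iff)
      moreover have "\<forall>i\<in>I. (\<lambda>i\<in>I. V i \<inter> V' i) i \<inter> Y i \<subseteq> (\<lambda>i\<in>I. Z i \<inter> Z' i) i"
        using V(3,4) by auto
      ultimately show ?thesis
        using inter[OF V(1,2)] by blast
    qed
    show "Z' \<in> ?G" if "Z \<in> ?G" "Z' \<in> (\<Pi>\<^sub>E i\<in>I. Pow (A i))" "\<forall>i\<in>I. Z i \<subseteq> Z' i" for Z Z'
    proof -
      obtain V where "V \<in> U" "\<forall>i\<in>I. V i \<inter> Y i \<subseteq> Z i"
        using \<open>Z \<in> ?G\<close> by blast
      moreover from this have "\<forall>i\<in>I. V i \<inter> Y i \<subseteq> Z' i"
        using that(3) by (meson order_trans)
      ultimately show ?thesis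
        using that(2) by blast
    qed
  qed blast
  ultimately have "(\<lambda>i\<in>I. {}) \<in> ?G"
    unfolding proper_product_Pow_filter_iff by blast
  then obtain V where V: "V \<in> U" "\<forall>i\<in>I. V i \<inter> Y i = {}"
    by auto
  show ?thesis
  proof (rule up[OF V(1)])
    show "V i \<subseteq> (\<lambda>i\<in>I. A i - Y i) i" if "i \<in> I" for i
      using V sub[OF V(1)] that by (auto simp: PiE_iff)
  qed (auto simp: PiE_iff)
qed


section \<open>Maximal ideals of the product\<close>

lemma product_ring_simps:
  "carrier (product_ring I D) = (\<Pi>\<^sub>E i\<in>I. carrier (D i))"
  "x \<otimes>\<^bsub>product_ring I D\<^esub> y = (\<lambda>i\<in>I. x i \<otimes>\<^bsub>D i\<^esub> y i)"
  "x \<oplus>\<^bsub>product_ring I D\<^esub> y = (\<lambda>i\<in>I. x i \<oplus>\<^bsub>D i\<^esub> y i)"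
  "\<one>\<^bsub>product_ring I D\<^esub> = (\<lambda>i\<in>I. \<one>\<^bsub>D i\<^esub>)"
  "\<zero>\<^bsub>product_ring I D\<^esub> = (\<lambda>i\<in>I. \<zero>\<^bsub>D i\<^esub>)"
  by (simp_all add: product_ring_def)

text \<open>The filter laws make the set an ideal. Componentwise finiteness of \<open>Y\<close>
  allows \<open>one_split_finite\<close> in each component, and the resulting equations glue to one
  in the product.\<close>

lemma filter_ideal_maximal:
  fixes D :: "'i \<Rightarrow> ('a, 'm) ring_scheme"
  assumes D: "\<And>i. i \<in> I \<Longrightarrow> cring (D i)"
    and U: "lattice_ultrafilter (max_algebra I D) U"
    and "\<exists>Y\<in>U. \<forall>i\<in>I. finite (Y i)"
  shows "filter_ideal I D U \<in> max_spec (product_ring I D)"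
proof -
  let ?R = "product_ring I D" and ?S = "locus_family I D"
  obtain Y where Y: "Y \<in> U" "\<forall>i\<in>I. finite (Y i)"
    using assms(3) by blast
  interpret R: cring ?R
    by (rule product_ring_cring[OF D])
  have "proper_lattice_filter (product_Pow I (\<lambda>i. max_spec (D i))) U"
    using U by (simp add: lattice_ultrafilter_def max_algebra_def)
  then have filt: "lattice_filter (product_Pow I (\<lambda>i. max_spec (D i))) U" and bot: "(\<lambda>i\<in>I. {}) \<notin> U"
    by (simp_all add: proper_product_Pow_filter_iff)
  note inter = product_Pow_filter_Int[OF filt]
  \<comment> \<open>Membership of a locus in \<open>U\<close> needs checking only at the points of
    some \<open>V\<close> in \<open>U\<close>; all closure properties below reduce to this.\<close>
  have up: "?S a \<in> U"
    if "V \<in> U" and *: "\<And>i N. i \<in> I \<Longrightarrow> N \<in> V i \<Longrightarrow> N \<in> max_spec (D i) \<Longrightarrow> a i \<in> N" for V a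
  proof (rule product_Pow_filter_mono[OF filt that(1)])
    show "?S a \<in> (\<Pi>\<^sub>E i\<in>I. Pow (max_spec (D i)))"
      using locus_family_closed[of I D a] by (simp add: max_algebra_def product_Pow_def)
    show "V i \<subseteq> ?S a i" if i: "i \<in> I" for i
    proof -
      have "V \<in> (\<Pi>\<^sub>E i\<in>I. Pow (max_spec (D i)))"
        using filt \<open>V \<in> U\<close> unfolding lattice_filter_product_Pow_iff by blast
      then have "V i \<subseteq> max_spec (D i)"
        using i by (simp add: PiE_iff)
      then show ?thesis
        using * i by (auto simp: locus_family_def max_locus_def)
    qed
  qed
  have S: "a i \<in> N" if "i \<in> I" "N \<in> ?S a i" for a i N
    using that by (simp add: locus_family_def max_locus_def)
  have idl: "ideal N (D i)" if "N \<in> max_spec (D i)" for i N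
    by (rule max_specD(1)[OF that])
  show ?thesis
  proof (rule R.max_specI_one_split)
    show "ideal (filter_ideal I D U) ?R"
    proof (rule R.idealI_closed)
      show "\<zero>\<^bsub>?R\<^esub> \<in> filter_ideal I D U"
        using up[OF Y(1), of "\<zero>\<^bsub>?R\<^esub>"] R.zero_closed idl
        by (auto simp: filter_ideal_def product_ring_simps additive_subgroup.zero_closed ideal.axioms(1))
      show "a \<oplus>\<^bsub>?R\<^esub> b \<in> filter_ideal I D U"
        if "a \<in> filter_ideal I D U" "b \<in> filter_ideal I D U" for a b
      proof -
        have ab: "a \<in> carrier ?R" "b \<in> carrier ?R" "?S a \<in> U" "?S b \<in> U"
          using that by (auto simp: filter_ideal_def)
        have "?S (a \<oplus>\<^bsub>?R\<^esub> b) \<in> U"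
          by (rule up[OF inter[OF ab(3,4)]])
            (auto simp: product_ring_simps S
              intro!: additive_subgroup.a_closed[OF ideal.axioms(1)[OF idl]])
        with ab(1,2) show ?thesis
          by (simp add: filter_ideal_def)
      qed
      show "r \<otimes>\<^bsub>?R\<^esub> a \<in> filter_ideal I D U"
        if r: "r \<in> carrier ?R" and "a \<in> filter_ideal I D U" for r a
      proof -
        have a: "a \<in> carrier ?R" "?S a \<in> U"
          using that by (auto simp: filter_ideal_def)
        have "?S (r \<otimes>\<^bsub>?R\<^esub> a) \<in> U"
          by (rule up[OF a(2)])
            (use r in \<open>auto simp: product_ring_simps S intro!: ideal.I_l_closed[OF idl]\<close>)
        with r a(1) show ?thesis
          by (simp add: filter_ideal_def)
      qed
    qed (auto simp: filter_ideal_def)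
    have "?S \<one>\<^bsub>?R\<^esub> = (\<lambda>i\<in>I. {})"
      by (auto simp: locus_family_def max_locus_def product_ring_simps
          dest: max_specD(2) intro!: restrict_ext)
    then show "\<one>\<^bsub>?R\<^esub> \<notin> filter_ideal I D U"
      using bot by (simp add: filter_ideal_def)
    fix a assume a: "a \<in> carrier ?R" "a \<notin> filter_ideal I D U"
    then have "?S a \<notin> U"
      by (simp add: filter_ideal_def)
    then have compl: "(\<lambda>i\<in>I. max_spec (D i) - ?S a i) \<in> U"
      using lattice_ultrafilter_complement[OF U[unfolded max_algebra_def]] locus_family_closed[of I D a]
      by (simp add: max_algebra_def product_Pow_def)
    \<comment> \<open>The part of \<open>Y\<close> where \<open>a\<close> does not vanish: still in
      \<open>U\<close>, and finite in every component.\<close>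
    define Z where "Z = (\<lambda>i\<in>I. Y i \<inter> (\<lambda>i\<in>I. max_spec (D i) - ?S a i) i)"
    have Z: "Z \<in> U"
      unfolding Z_def by (rule inter[OF Y(1) compl])
    have "\<exists>r\<in>carrier (D i). \<exists>b\<in>carrier (D i). \<one>\<^bsub>D i\<^esub> = r \<otimes>\<^bsub>D i\<^esub> a i \<oplus>\<^bsub>D i\<^esub> b \<and> (\<forall>N\<in>Z i. b \<in> N)"
      if i: "i \<in> I" for i
      by (rule cring.one_split_finite[OF D[OF i]])
        (use i a(1) Y(2) in \<open>auto simp: Z_def product_ring_simps locus_family_def max_locus_def\<close>)
    then obtain r b where rb: "\<And>i. i \<in> I \<Longrightarrow> r i \<in> carrier (D i)" "\<And>i. i \<in> I \<Longrightarrow> b i \<in> carrier (D i)"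
      "\<And>i. i \<in> I \<Longrightarrow> \<one>\<^bsub>D i\<^esub> = r i \<otimes>\<^bsub>D i\<^esub> a i \<oplus>\<^bsub>D i\<^esub> b i"
      "\<And>i N. i \<in> I \<Longrightarrow> N \<in> Z i \<Longrightarrow> b i \<in> N"
      by metis
    \<comment> \<open>\<open>b i\<close> lies in every member of \<open>Z i\<close>, so the locus of
      \<open>b\<close> is above \<open>Z\<close>.\<close>
    have "?S (restrict b I) \<in> U"
      by (rule up[OF Z]) (use rb(4) in auto)
    then have "restrict b I \<in> filter_ideal I D U"
      using rb(2) by (auto simp: filter_ideal_def product_ring_simps)
    moreover have "restrict r I \<in> carrier ?R"
      using rb(1) by (auto simp: product_ring_simps)
    moreover have "\<one>\<^bsub>?R\<^esub> = restrict r I \<otimes>\<^bsub>?R\<^esub> a \<oplus>\<^bsub>?R\<^esub> restrict b I"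
      using rb(3) by (auto simp: product_ring_simps intro!: restrict_ext)
    ultimately show "\<exists>r\<in>carrier ?R. \<exists>m\<in>filter_ideal I D U. \<one>\<^bsub>?R\<^esub> = r \<otimes>\<^bsub>?R\<^esub> a \<oplus>\<^bsub>?R\<^esub> m"
      by blast
  qed
qed

section \<open>From maximal ideals of the product to ultrafilters\<close>

text \<open>Coefficients chosen independently in each component form elements of the full product,
  so componentwise combinations of a fixed finite set \<open>A\<close> are genuine combinations. The
  induction removes one generator from all components at once.\<close>

lemma product_ring_ideal_genideal:
  fixes D :: "'i \<Rightarrow> ('a, 'm) ring_scheme"
  assumes D: "\<And>i. i \<in> I \<Longrightarrow> cring (D i)"
    and M: "ideal M (product_ring I D)"
    and "finite A" "A \<subseteq> M" "x \<in> carrier (product_ring I D)"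
    and "\<And>i. i \<in> I \<Longrightarrow> x i \<in> Idl\<^bsub>D i\<^esub> ((\<lambda>a. a i) ` A)"
  shows "x \<in> M"
  using assms(3-)
proof (induction A arbitrary: x rule: finite_induct)
  case empty
  have "x i = \<zero>\<^bsub>D i\<^esub>" if i: "i \<in> I" for i
  proof -
    interpret cring "D i" by (rule D[OF i])
    show ?thesis
      using empty.prems(3)[OF i] genideal_minimal[OF zeroideal, of "{}"] by auto
  qed
  then have "x = \<zero>\<^bsub>product_ring I D\<^esub>"
    using empty.prems(2) by (auto simp: product_ring_simps PiE_iff extensional_def)
  then show ?case
    using M by (simp add: additive_subgroup.zero_closed ideal.axioms(1))
next
  case (insert a A)
  interpret M: ideal M "product_ring I D" by (rule M)
  have sub: "insert a A \<subseteq> (\<Pi>\<^sub>E i\<in>I. carrier (D i))"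
    using insert.prems(1) M.a_subset by (auto simp: product_ring_simps)
  have "\<exists>r y. r \<in> carrier (D i) \<and> y \<in> Idl\<^bsub>D i\<^esub> ((\<lambda>a. a i) ` A) \<and> x i = r \<otimes>\<^bsub>D i\<^esub> a i \<oplus>\<^bsub>D i\<^esub> y"
    if i: "i \<in> I" for i
  proof -
    have "a i \<in> carrier (D i)" "(\<lambda>a. a i) ` A \<subseteq> carrier (D i)"
      using sub i by auto
    moreover have "x i \<in> Idl\<^bsub>D i\<^esub> (insert (a i) ((\<lambda>a. a i) ` A))"
      using insert.prems(3)[OF i] by simp
    ultimately show ?thesis
      by (rule cring.genideal_insertE[OF D[OF i]]) blast
  qed
  then obtain r y where r: "\<And>i. i \<in> I \<Longrightarrow> r i \<in> carrier (D i)"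
    and y: "\<And>i. i \<in> I \<Longrightarrow> y i \<in> Idl\<^bsub>D i\<^esub> ((\<lambda>a. a i) ` A)"
    and x: "\<And>i. i \<in> I \<Longrightarrow> x i = r i \<otimes>\<^bsub>D i\<^esub> a i \<oplus>\<^bsub>D i\<^esub> y i"
    by metis
  have "y i \<in> carrier (D i)" if i: "i \<in> I" for i
  proof -
    interpret cring "D i" by (rule D[OF i])
    have "(\<lambda>a. a i) ` A \<subseteq> carrier (D i)"
      using sub i by auto
    then show ?thesis
      using y[OF i] ideal.Icarr[OF genideal_ideal] by blast
  qed
  \<comment> \<open>The glued remainder is handled by the induction hypothesis, the glued multiple
    of \<open>a\<close> by the ideal property of \<open>M\<close>.\<close>
  then have "restrict y I \<in> M"
    using y insert.prems(1) by (intro insert.IH) (auto simp: product_ring_simps)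
  moreover have "restrict r I \<otimes>\<^bsub>product_ring I D\<^esub> a \<in> M"
    using r insert.prems(1) by (intro M.I_l_closed) (auto simp: product_ring_simps)
  moreover have "x = restrict r I \<otimes>\<^bsub>product_ring I D\<^esub> a \<oplus>\<^bsub>product_ring I D\<^esub> restrict y I"
    using x insert.prems(2) by (auto simp: product_ring_simps PiE_iff extensional_def)
  ultimately show ?case
    using M.a_closed by simp
qed

text \<open>Otherwise, by Krull's theorem, the components of \<open>A\<close> generate the unit
  ideal everywhere, and \<open>product_ring_ideal_genideal\<close> puts the identity into
  \<open>M\<close>.\<close>

lemma product_ring_ideal_finite_meet:
  fixes D :: "'i \<Rightarrow> ('a, 'm) ring_scheme"
  assumes D: "\<And>i. i \<in> I \<Longrightarrow> cring (D i)"
    and M: "ideal M (product_ring I D)" "\<one>\<^bsub>product_ring I D\<^esub> \<notin> M"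
    and A: "finite A" "A \<subseteq> M"
  shows "\<exists>i\<in>I. \<exists>N\<in>max_spec (D i). \<forall>a\<in>A. a i \<in> N"
proof (rule ccontr)
  assume no: "\<not> ?thesis"
  interpret R: cring "product_ring I D"
    by (rule product_ring_cring[OF D])
  have sub: "A \<subseteq> carrier (product_ring I D)"
    using A(2) ideal.Icarr[OF M(1)] by blast
  have "\<one>\<^bsub>product_ring I D\<^esub> i \<in> Idl\<^bsub>D i\<^esub> ((\<lambda>a. a i) ` A)" if i: "i \<in> I" for i
  proof (rule ccontr)
    interpret cring "D i" by (rule D[OF i])
    have c: "(\<lambda>a. a i) ` A \<subseteq> carrier (D i)"
      using sub i by (auto simp: product_ring_simps)
    assume "\<one>\<^bsub>product_ring I D\<^esub> i \<notin> Idl\<^bsub>D i\<^esub> ((\<lambda>a. a i) ` A)"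
    then obtain N where "N \<in> max_spec (D i)" "Idl\<^bsub>D i\<^esub> ((\<lambda>a. a i) ` A) \<subseteq> N"
      using exists_maximalideal[OF genideal_ideal[OF c]] i by (auto simp: product_ring_simps)
    then show False
      using no i genideal_self[OF c] by blast
  qed
  then show False
    using product_ring_ideal_genideal[OF D M(1) A R.one_closed] M(2) by blast
qed

text \<open>If \<open>t\<close> is a family of non-zero non-units and \<open>1 = r t + m\<close>, then no component of \<open>m\<close>
  vanishes.\<close>
lemma max_spec_product_ring_nowhere_zero:
  fixes D :: "'i \<Rightarrow> ('a, 'm) ring_scheme"
  assumes D: "\<And>i. i \<in> I \<Longrightarrow> cring (D i)" "\<And>i. i \<in> I \<Longrightarrow> \<one>\<^bsub>D i\<^esub> \<noteq> \<zero>\<^bsub>D i\<^esub>"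
      "\<And>i. i \<in> I \<Longrightarrow> \<not> field (D i)"
    and M: "M \<in> max_spec (product_ring I D)"
  shows "\<exists>m\<in>M. \<forall>i\<in>I. m i \<noteq> \<zero>\<^bsub>D i\<^esub>"
proof -
  interpret R: cring "product_ring I D"
    by (rule product_ring_cring[OF D(1)])
  have "\<exists>t N. N \<in> max_spec (D i) \<and> t \<in> N \<and> t \<noteq> \<zero>\<^bsub>D i\<^esub>" if "i \<in> I" for i
    using cring.max_spec_nonzero_member[OF D(1)[OF that] D(2)[OF that] D(3)[OF that]] by metis
  then obtain t N where t: "\<And>i. i \<in> I \<Longrightarrow> N i \<in> max_spec (D i)" "\<And>i. i \<in> I \<Longrightarrow> t i \<in> N i"
    "\<And>i. i \<in> I \<Longrightarrow> t i \<noteq> \<zero>\<^bsub>D i\<^esub>"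
    by metis
  \<comment> \<open>If the glued family \<open>t\<close> lies in \<open>M\<close>, it is itself the
    required element; otherwise it is comaximal with \<open>M\<close>.\<close>
  show ?thesis
  proof (cases "restrict t I \<in> M")
    case True
    then show ?thesis
      by (rule rev_bexI) (simp add: t(3))
  next
    case False
    have "restrict t I \<in> carrier (product_ring I D)"
      using ideal.Icarr[OF max_specD(1)[OF t(1)] t(2)] by (auto simp: product_ring_simps)
    then obtain r m where rm: "r \<in> carrier (product_ring I D)" "m \<in> M"
      "\<one>\<^bsub>product_ring I D\<^esub> = r \<otimes>\<^bsub>product_ring I D\<^esub> restrict t I \<oplus>\<^bsub>product_ring I D\<^esub> m"
      by (rule R.max_spec_one_split[OF M _ False])
    have "m i \<noteq> \<zero>\<^bsub>D i\<^esub>" if i: "i \<in> I" for i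
    proof
      interpret N: ideal "N i" "D i"
        by (rule max_specD(1)[OF t(1)[OF i]])
      have "r i \<in> carrier (D i)"
        using rm(1) i by (auto simp: product_ring_simps)
      then have rt: "r i \<otimes>\<^bsub>D i\<^esub> t i \<in> N i"
        by (rule N.I_l_closed[OF t(2)[OF i]])
      \<comment> \<open>A zero component of \<open>m\<close> would make \<open>\<one>\<close> a
        multiple of \<open>t i\<close>, which lies in the proper ideal \<open>N i\<close>.\<close>
      assume "m i = \<zero>\<^bsub>D i\<^esub>"
      then have "\<one>\<^bsub>D i\<^esub> = r i \<otimes>\<^bsub>D i\<^esub> t i"
        using fun_cong[OF rm(3), of i] i N.Icarr[OF rt] by (simp add: product_ring_simps)
      with rt show False
        using max_specD(2)[OF t(1)[OF i]] by simp
    qed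
    with rm(2) show ?thesis
      by blast
  qed
qed

text \<open>The loci of single elements of \<open>M\<close> need not be downward directed (consider a Dedekind domain with
  non-torsion class group), so the filter is generated by finite meets of them.\<close>
lemma product_ring_ideal_ultrafilter:
  fixes D :: "'i \<Rightarrow> ('a, 'm) ring_scheme"
  assumes D: "\<And>i. i \<in> I \<Longrightarrow> cring (D i)"
    and M: "ideal M (product_ring I D)" "\<one>\<^bsub>product_ring I D\<^esub> \<notin> M"
  obtains U where "lattice_ultrafilter (max_algebra I D) U" "M \<subseteq> filter_ideal I D U"
proof -
  \<comment> \<open>For finite \<open>A\<close> the inner set is the \<open>i\<close>-th component
    of the meet of the loci of its members; for \<open>A = {}\<close> it is all of
    \<open>max_spec (D i)\<close>, which makes \<open>F\<close> non-empty.\<close>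
  define F where "F = {Y \<in> (\<Pi>\<^sub>E i\<in>I. Pow (max_spec (D i))).
    \<exists>A. finite A \<and> A \<subseteq> M \<and> (\<forall>i\<in>I. {N \<in> max_spec (D i). \<forall>a\<in>A. a i \<in> N} \<subseteq> Y i)}"
  have FI: "Y \<in> F" if "Y \<in> (\<Pi>\<^sub>E i\<in>I. Pow (max_spec (D i)))" "finite A" "A \<subseteq> M"
    "\<And>i. i \<in> I \<Longrightarrow> {N \<in> max_spec (D i). \<forall>a\<in>A. a i \<in> N} \<subseteq> Y i" for Y A
    unfolding F_def by (intro CollectI conjI exI[of _ A] ballI that)
  have FE: "\<exists>A. finite A \<and> A \<subseteq> M \<and> (\<forall>i\<in>I. {N \<in> max_spec (D i). \<forall>a\<in>A. a i \<in> N} \<subseteq> Y i)"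
    if "Y \<in> F" for Y
    using that unfolding F_def by (elim CollectE conjE)
  have sub: "F \<subseteq> (\<Pi>\<^sub>E i\<in>I. Pow (max_spec (D i)))"
    unfolding F_def by (rule Collect_restrict)
  have "proper_lattice_filter (max_algebra I D) F"
    unfolding max_algebra_def proper_product_Pow_filter_iff lattice_filter_product_Pow_iff
  proof (intro conjI ballI impI)
    show "F \<subseteq> (\<Pi>\<^sub>E i\<in>I. Pow (max_spec (D i)))"
      by (rule sub)
    show "F \<noteq> {}"
      using FI[of "\<lambda>i\<in>I. max_spec (D i)" "{}"] by (auto simp: PiE_iff)
    show "(\<lambda>i\<in>I. V i \<inter> Y i) \<in> F" if XY: "V \<in> F" "Y \<in> F" for V Y
    proof -
      obtain A B where AB: "finite A" "A \<subseteq> M" "finite B" "B \<subseteq> M"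
        and A: "\<forall>i\<in>I. {N \<in> max_spec (D i). \<forall>a\<in>A. a i \<in> N} \<subseteq> V i"
        and B: "\<forall>i\<in>I. {N \<in> max_spec (D i). \<forall>a\<in>B. a i \<in> N} \<subseteq> Y i"
        using FE[OF XY(1)] FE[OF XY(2)] by (elim exE conjE) (rule that)
      show ?thesis
      \<comment> \<open>Uniting the sets of generators corresponds to intersecting their common
        loci.\<close>
      proof (rule FI[of _ "A \<union> B"])
        show "(\<lambda>i\<in>I. V i \<inter> Y i) \<in> (\<Pi>\<^sub>E i\<in>I. Pow (max_spec (D i)))"
          using subsetD[OF sub XY(1)] by (auto simp: PiE_iff)
        show "{N \<in> max_spec (D i). \<forall>a\<in>A \<union> B. a i \<in> N} \<subseteq> (\<lambda>i\<in>I. V i \<inter> Y i) i" if "i \<in> I" for i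
          using bspec[OF A that] bspec[OF B that] that by auto
      qed (use AB in auto)
    qed
    show "Y \<in> F" if VY: "V \<in> F" "Y \<in> (\<Pi>\<^sub>E i\<in>I. Pow (max_spec (D i)))" "\<forall>i\<in>I. V i \<subseteq> Y i" for V Y
    proof -
      obtain A where A: "finite A" "A \<subseteq> M"
        "\<forall>i\<in>I. {N \<in> max_spec (D i). \<forall>a\<in>A. a i \<in> N} \<subseteq> V i"
        using FE[OF VY(1)] by (elim exE conjE) (rule that)
      show ?thesis
        by (rule FI[OF VY(2) A(1,2)]) (use A(3) VY(3) in blast)
    qed
    \<comment> \<open>The bottom element would come from a finite subset of \<open>M\<close> without
      a common maximal ideal in any component.\<close>
    show "(\<lambda>i\<in>I. {}) \<notin> F"
    proof
      assume "(\<lambda>i\<in>I. {}) \<in> F"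
      from FE[OF this] obtain A where A: "finite A" "A \<subseteq> M"
        "\<forall>i\<in>I. {N \<in> max_spec (D i). \<forall>a\<in>A. a i \<in> N} \<subseteq> (\<lambda>i\<in>I. {}) i"
        by (elim exE conjE) (rule that)
      then show False
        using product_ring_ideal_finite_meet[OF D M A(1,2)] by auto
    qed
  qed
  then obtain U where U: "lattice_ultrafilter (max_algebra I D) U" "F \<subseteq> U"
    unfolding max_algebra_def by (rule lattice_ultrafilter_extends)
  have "M \<subseteq> filter_ideal I D U"
  proof
    fix a assume a: "a \<in> M"
    have "locus_family I D a \<in> F"
      by (rule FI[of _ "{a}"])
        (use a locus_family_closed[of I D a] in
          \<open>auto simp: max_algebra_def product_Pow_def locus_family_def max_locus_def\<close>)
    then show "a \<in> filter_ideal I D U"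
      using U(2) ideal.Icarr[OF M(1) a] by (auto simp: filter_ideal_def)
  qed
  with U(1) show thesis
    by (rule that)
qed

theorem corollary2p16:
  fixes I :: "'i set" and D :: "'i \<Rightarrow> ('a, 'm) ring_scheme"
  assumes "\<And>i. i \<in> I \<Longrightarrow> domain (D i)"
    and "\<And>i. i \<in> I \<Longrightarrow> finite_character (D i)"
    and "\<And>i. i \<in> I \<Longrightarrow> \<not> field (D i)"
  shows "max_spec (product_ring I D) =
    {filter_ideal I D U | U. lattice_ultrafilter (max_algebra I D) U
        \<and> (\<exists>Y\<in>U. \<forall>i\<in>I. finite (Y i))}"
proof -
  have D: "cring (D i)" "\<one>\<^bsub>D i\<^esub> \<noteq> \<zero>\<^bsub>D i\<^esub>" if "i \<in> I" for i
    using assms(1)[OF that] by (simp_all add: domain.axioms(1) domain.one_not_zero)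
  have "\<exists>U. M = filter_ideal I D U \<and> lattice_ultrafilter (max_algebra I D) U
      \<and> (\<exists>Y\<in>U. \<forall>i\<in>I. finite (Y i))"
    if M: "M \<in> max_spec (product_ring I D)" for M
  proof -
    obtain U where U: "lattice_ultrafilter (max_algebra I D) U" "M \<subseteq> filter_ideal I D U"
      by (rule product_ring_ideal_ultrafilter[OF D(1) max_specD[OF M]])
    obtain m where m: "m \<in> M" "\<forall>i\<in>I. m i \<noteq> \<zero>\<^bsub>D i\<^esub>"
      using max_spec_product_ring_nowhere_zero[OF D assms(3) M] by blast
    have "m \<in> carrier (product_ring I D)" "locus_family I D m \<in> U"
      using m(1) U(2) by (auto simp: filter_ideal_def)
    \<comment> \<open>The locus of \<open>m\<close> is the componentwise finite member of
      \<open>U\<close>: finite character applies because every \<open>m i\<close> is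
      non-zero.\<close>
    moreover from this have fin: "finite (locus_family I D m i)" if "i \<in> I" for i
      using assms(2)[OF that] m(2) that that
      by (auto simp: locus_family_def finite_character_def product_ring_simps)
    ultimately have max: "filter_ideal I D U \<in> max_spec (product_ring I D)"
      using filter_ideal_maximal[OF D(1) U(1)] by blast
    interpret maximalideal M "product_ring I D"
      using M by (simp add: max_spec_def)
    \<comment> \<open>The maximal ideal \<open>M\<close> is contained in
      \<open>filter_ideal I D U\<close>, which omits the identity, so the two coincide.\<close>
    have "M = filter_ideal I D U"
      using I_maximal[OF max_specD(1)[OF max] U(2)] max_specD(2)[OF max]
      by (auto simp: filter_ideal_def)
    with U(1) \<open>locus_family I D m \<in> U\<close> fin show ?thesis
      by blast
  qed
  moreover have "filter_ideal I D U \<in> max_spec (product_ring I D)"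
    if "lattice_ultrafilter (max_algebra I D) U" "\<exists>Y\<in>U. \<forall>i\<in>I. finite (Y i)" for U
    using D(1) that by (rule filter_ideal_maximal)
  ultimately show ?thesis
    by (intro equalityI subsetI) (simp, elim CollectE exE conjE, simp)
qed

end
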